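(* Let $A$ be the disk algebra and let $f\in A$ have Taylor expansion $f(z)=\sum_{n=0}^{\infty}a_nz^n$ on the open unit disk. Then $$\sum_{n=0}^{\infty}|a_n|\,r^n\le \|f\|_{\infty}\qquad\text{for all } 0\le r\le \tfrac13 .$$ Moreover, $\tfrac13$ is the best possible constant: for every real $\rho$ with $\tfrac13<\rho<1$ there exist $f\in A$, with Taylor expansion $f(z)=\sum_{n=0}^{\infty}a_nz^n$, and $r\in[0,\rho]$ such that $\sum_{n=0}^{\infty}|a_n|r^n>\|f\|_{\infty}$.
   Context: The disk algebra $A$ is the Banach algebra of complex-valued functions that are holomorphic on the open unit disk $\{z\in\mathbb{C}:|z|<1\}$ and have continuous boundary values (i.e. extend continuously to the closed unit disk $\{|z|\le 1\}$), with norm $\|f\|_{\infty}=\sup\{|f(z)|:|z|\le 1\}$. *)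

theory Defs
  imports "HOL-Analysis.Analysis"
begin

(* HOL functions are total: a member of the disk algebra is represented by any
   f :: complex => complex whose restriction to the closed unit disk has the required
   properties.  Values outside the closed disk are irrelevant throughout. *)
definition disk_algebra :: "(complex \<Rightarrow> complex) set" where
  "disk_algebra = {f. f holomorphic_on ball 0 1 \<and> continuous_on (cball 0 1) f}"

definition disk_norm :: "(complex \<Rightarrow> complex) \<Rightarrow> real" where
  "disk_norm f = (SUP z\<in>cball 0 1. norm (f z))"

definition has_taylor_expansion_on_disk :: "(complex \<Rightarrow> complex) \<Rightarrow> (nat \<Rightarrow> complex) \<Rightarrow> bool" where
  "has_taylor_expansion_on_disk f a \<longleftrightarrow> (\<forall>z\<in>ball 0 1. (\<lambda>n. a n * z ^ n) sums f z)"

end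

theory Submission
  imports Defs
begin

text \<open>
  Write M for the norm of f and choose a unimodular u with u a_0 = |a_0|. On the disk the function
  M - u f has nonnegative real part, so Caratheodory's coefficient estimate gives
  |a_n| \<le> 2 (M - |a_0|) for n \<ge> 1. Since the sum of 3^(-n) over n \<ge> 1 is 1/2, the majorant series
  at r \<le> 1/3 is at most |a_0| + (M - |a_0|) = M. Optimality is witnessed by the disk automorphisms
  (p - z) / (1 - p z) with p close to 1, whose majorant series at \<rho> exceeds 1 as soon as
  \<rho> (1 + 2 p) > 1.
\<close>

section \<open>Fourier coefficients of absolutely convergent series on the circle\<close>

lemma has_integral_cis_period:
  fixes k :: int
  shows "((\<lambda>t. cis (of_int k * t)) has_integral (if k = 0 then 2 * pi else 0)) {0..2 * pi}"
proof (cases "k = 0")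
  case True
  then show ?thesis
    using has_integral_const_real[of "1::complex" 0 "2 * pi"] by (simp add: scaleR_conv_of_real)
next
  case False
  define G where "G = (\<lambda>t. cis (of_int k * t) / (\<i> * of_int k))"
  have "((\<lambda>t. cis (of_int k * t)) has_integral G (2 * pi) - G 0) {0..2 * pi}"
  proof (rule fundamental_theorem_of_calculus)
    fix t :: real
    \<comment> \<open>The antiderivative is differentiated as a function of a complex variable and
      then restricted to the real line. Its periodicity makes the two boundary values
      cancel.\<close>
    have "((\<lambda>z. exp (\<i> * of_int k * z) / (\<i> * of_int k)) has_field_derivative
        exp (\<i> * of_int k * of_real t)) (at (of_real t))"
      by (rule derivative_eq_intros refl | use False in simp)+
    from has_vector_derivative_real_field[OF this]
    show "(G has_vector_derivative cis (of_int k * t)) (at t within {0..2 * pi})"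
      by (simp add: G_def cis_conv_exp mult.assoc has_vector_derivative_at_within)
  qed simp
  moreover have "cis (of_int k * (2 * pi)) = 1"
    using cis_multiple_2pi[of "of_int k"] by (simp add: mult_ac)
  ultimately show ?thesis
    using False by (simp add: G_def)
qed

text \<open>The majorant \<open>norm (c k)\<close> makes the series converge uniformly, so it may be
  integrated term by term, and orthogonality leaves only the term \<open>k = m\<close>. Letting
  \<open>m\<close> range over the integers also records that negative frequencies contribute
  nothing.\<close>

lemma has_integral_fourier_coeff:
  fixes c :: "nat \<Rightarrow> complex" and m :: int
  assumes "summable (\<lambda>k. norm (c k))"
  shows "((\<lambda>t. (\<Sum>k. c k * cis (of_nat k * t)) * cis (- of_int m * t)) has_integral
            (if m \<ge> 0 then 2 * pi * c (nat m) else 0)) {0..2 * pi}"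
proof -
  define h where "h = (\<lambda>k t. c k * cis (of_nat k * t) * cis (- of_int m * t))"
  define I where "I = (\<lambda>k. if int k = m then 2 * pi * c k else 0)"
  have h_int: "(h k has_integral I k) {0..2 * pi}" for k
  proof -
    have "h k = (\<lambda>t. c k * cis (of_int (int k - m) * t))"
      by (simp add: h_def fun_eq_iff cis_mult algebra_simps)
    moreover have "((\<lambda>t. c k * cis (of_int (int k - m) * t)) has_integral
        c k * (if int k - m = 0 then 2 * pi else 0)) {0..2 * pi}"
      by (intro has_integral_mult_right has_integral_cis_period)
    moreover have "c k * (if int k - m = 0 then 2 * pi else 0) = I k"
      by (simp add: I_def)
    ultimately show ?thesis by metis
  qed
  have sm: "summable (\<lambda>k. c k * cis (of_nat k * t))" for t
    by (rule summable_norm_cancel) (simp add: norm_mult assms)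
  have lim: "uniform_limit {0..2 * pi} (\<lambda>n t. \<Sum>k<n. h k t) (\<lambda>t. \<Sum>k. h k t) sequentially"
    by (rule Weierstrass_m_test[OF _ assms]) (simp add: h_def norm_mult)
  have part: "((\<lambda>t. \<Sum>k<n. h k t) has_integral (\<Sum>k<n. I k)) {0..2 * pi}" for n
    by (intro has_integral_sum h_int) auto
  have cont: "continuous_on {0..2 * pi} (\<lambda>t. \<Sum>k<n. h k t)" for n
    unfolding h_def by (intro continuous_intros)
  \<comment> \<open>The limit theorem only asserts that suitable values \<open>S n\<close> and
    \<open>J\<close> exist; uniqueness of the integral identifies \<open>S n\<close> with the
    partial sums of \<open>I\<close>.\<close>
  obtain S J where S: "\<And>n. ((\<lambda>t. \<Sum>k<n. h k t) has_integral S n) {0..2 * pi}"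
    and J: "((\<lambda>t. \<Sum>k. h k t) has_integral J) {0..2 * pi}" and "S \<longlonglongrightarrow> J"
    using uniform_limit_integral[OF lim cont] by auto
  moreover have "S = (\<lambda>n. \<Sum>k<n. I k)"
    using has_integral_unique[OF S part] by blast
  ultimately have "I sums J"
    by (simp add: sums_def)
  have "I sums (if m \<ge> 0 then 2 * pi * c (nat m) else 0)"
  proof (cases "m \<ge> 0")
    case True
    then have "I = (\<lambda>k. if k = nat m then 2 * pi * c k else 0)"
      by (auto simp: I_def fun_eq_iff)
    then show ?thesis
      using True sums_single[of "nat m" "\<lambda>k. 2 * pi * c k"] by simp
  next
    case False
    then have "I = (\<lambda>k. 0)"
      by (auto simp: I_def fun_eq_iff)
    then show ?thesis using False by simp
  qed
  with \<open>I sums J\<close> have "J = (if m \<ge> 0 then 2 * pi * c (nat m) else 0)"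
    by (rule sums_unique2)
  moreover have "(\<Sum>k. h k t) = (\<Sum>k. c k * cis (of_nat k * t)) * cis (- of_int m * t)" for t
    unfolding h_def using suminf_mult2[OF sm] by simp
  ultimately show ?thesis using J by simp
qed

section \<open>Caratheodory's coefficient estimate\<close>

lemma unimodular_rotation:
  fixes z :: complex
  obtains u where "norm u = 1" "u * z = norm z"
proof (cases "z = 0")
  case True
  then show ?thesis using that[of 1] by simp
next
  case False
  then have "(cnj z / norm z) * z = norm z"
    by (simp add: complex_norm_square[symmetric] power2_eq_square mult.commute[of "cnj _"] mult_ac)
  then show ?thesis using that[of "cnj z / norm z"] False
    by (simp add: norm_divide)
qed

text \<open>The real part of the series stays nonnegative when multiplied by a nonnegative
  trigonometric polynomial with frequencies 0, \<open>n\<close> and \<open>-n\<close>. Integrating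
  gives a linear inequality between \<open>Re (c 0)\<close> and \<open>norm (c n)\<close>, since the
  series has no term of frequency \<open>-n\<close>.\<close>

lemma norm_coeff_le_twice_Re_const_coeff:
  fixes c :: "nat \<Rightarrow> complex"
  assumes summ: "summable (\<lambda>k. norm (c k))"
    and nonneg: "\<And>t. Re (\<Sum>k. c k * cis (of_nat k * t)) \<ge> 0"
    and "n > 0"
  shows "norm (c n) \<le> 2 * Re (c 0)"
proof -
  define F where "F = (\<lambda>t. \<Sum>k. c k * cis (of_nat k * t))"
  obtain u where u: "norm u = 1" "u * c n = norm (c n)"
    by (rule unimodular_rotation)
  \<comment> \<open>The sign makes the integral contribute \<open>- norm (c n)\<close>, so that its
    nonnegativity bounds \<open>norm (c n)\<close> from above.\<close>
  define v where "v = - u"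
  have v: "norm v = 1" "v * c n = - norm (c n)"
    using u by (simp_all add: v_def)
  define w where "w = (\<lambda>t. v * cis (- of_nat n * t))"
  have w: "norm (w t) = 1" for t
    by (simp add: w_def norm_mult v)
  \<comment> \<open>The weight \<open>2 + 2 * Re (w t)\<close> is nonnegative, and integrating F against it
      picks out exactly the coefficients c 0 and c n.\<close>
  have "((\<lambda>t. 2 * (F t * cis (- of_int 0 * t)) + v * (F t * cis (- of_int (int n) * t))
          + cnj v * (F t * cis (- of_int (- int n) * t))) has_integral
        2 * (if (0::int) \<ge> 0 then 2 * pi * c (nat 0) else 0)
          + v * (if int n \<ge> 0 then 2 * pi * c (nat (int n)) else 0)
          + cnj v * (if - int n \<ge> 0 then 2 * pi * c (nat (- int n)) else 0)) {0..2 * pi}"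
    unfolding F_def
    by (intro has_integral_add has_integral_mult_right has_integral_fourier_coeff summ)
  moreover have "2 * (F t * cis (- of_int 0 * t)) + v * (F t * cis (- of_int (int n) * t))
          + cnj v * (F t * cis (- of_int (- int n) * t)) = of_real (2 + 2 * Re (w t)) * F t" for t
  proof -
    have "of_real (2 * Re (w t)) = w t + cnj (w t)"
      by (simp add: complex_add_cnj)
    then show ?thesis by (simp add: w_def cis_cnj algebra_simps)
  qed
  ultimately have "((\<lambda>t. of_real (2 + 2 * Re (w t)) * F t) has_integral
      2 * (2 * pi * c 0) + 2 * pi * (v * c n)) {0..2 * pi}"
    using \<open>n > 0\<close> by (simp add: mult_ac)
  then have "((\<lambda>t. Re (of_real (2 + 2 * Re (w t)) * F t)) has_integral
      Re (2 * (2 * pi * c 0) + 2 * pi * (v * c n))) {0..2 * pi}"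
    by (rule has_integral_Re)
  then have "0 \<le> Re (2 * (2 * pi * c 0) + 2 * pi * (v * c n))"
  proof (rule has_integral_nonneg)
    fix t
    have "\<bar>Re (w t)\<bar> \<le> 1"
      using abs_Re_le_cmod[of "w t"] w by simp
    then show "0 \<le> Re (of_real (2 + 2 * Re (w t)) * F t)"
      using nonneg[of t] by (simp add: F_def del: of_real_add of_real_mult)
  qed
  also have "\<dots> = 2 * pi * (2 * Re (c 0) - norm (c n))"
    unfolding v by (simp add: algebra_simps)
  finally show ?thesis
    using pi_gt_zero by (simp add: zero_le_mult_iff)
qed

section \<open>Bohr's inequality up to radius 1/3\<close>

text \<open>A real \<open>SUP\<close> is an upper bound only for a set known to be bounded above;
  compactness of the closed disk supplies this.\<close>

lemma norm_le_disk_norm: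
  assumes "f \<in> disk_algebra" "norm z \<le> 1"
  shows "norm (f z) \<le> disk_norm f"
proof -
  have "compact ((\<lambda>z. norm (f z)) ` cball 0 1)"
    using assms by (intro compact_continuous_image continuous_intros) (auto simp: disk_algebra_def)
  then have "bdd_above ((\<lambda>z. norm (f z)) ` cball 0 1)"
    by (intro bounded_imp_bdd_above compact_imp_bounded)
  then show ?thesis
    unfolding disk_norm_def using assms(2) by (intro cSUP_upper) auto
qed

text \<open>The Taylor series need not converge absolutely on the unit circle, so the coefficient
  estimate is applied on circles of radius \<open>s < 1\<close>, and then \<open>s\<close> tends to
  1.\<close>

lemma taylor_coeff_le:
  assumes f: "f \<in> disk_algebra" and a: "has_taylor_expansion_on_disk f a" and "n > 0"
  shows "norm (a n) \<le> 2 * (disk_norm f - norm (a 0))"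
proof -
  obtain u where u: "norm u = 1" "u * a 0 = norm (a 0)"
    by (rule unimodular_rotation)
  have bound: "norm (a n) * s ^ n \<le> 2 * (disk_norm f - norm (a 0))" if s: "0 < s" "s < 1" for s :: real
  proof -
    \<comment> \<open>These are the coefficients of \<open>disk_norm f - u * f (s * z)\<close>. The
      choice of \<open>u\<close> gives \<open>Re (c 0) = disk_norm f - norm (a 0)\<close>.\<close>
    define c where "c = (\<lambda>k. (if k = 0 then of_real (disk_norm f) else 0) - u * (a k * of_real s ^ k))"
    \<comment> \<open>Convergence at a point of modulus strictly between \<open>s\<close> and 1
      yields absolute convergence at radius \<open>s\<close>.\<close>
    have "summable (\<lambda>k. a k * of_real ((s + 1) / 2) ^ k)"
      using a s unfolding has_taylor_expansion_on_disk_def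
      by (intro sums_summable[of _ "f (of_real ((s + 1) / 2))"]) (auto simp del: of_real_divide of_real_add)
    then have "summable (\<lambda>k. norm (a k * of_real s ^ k))"
      by (rule powser_insidea) (use s in \<open>simp del: of_real_divide of_real_add\<close>)
    then have "summable (\<lambda>k. (if k = 0 then \<bar>disk_norm f\<bar> else 0) + norm (a k * of_real s ^ k))"
      by (intro summable_add summable_single)
    then have "summable (\<lambda>k. norm (c k))"
      by (rule summable_comparison_test'[where N = 0])
         (auto simp: c_def norm_mult u intro!: norm_triangle_ineq4[THEN order_trans])
    moreover have "Re (\<Sum>k. c k * cis (of_nat k * t)) \<ge> 0" for t
    proof -
      let ?z = "of_real s * cis t"
      have z: "norm ?z < 1" using s by (simp add: norm_mult)
      then have "(\<lambda>k. a k * ?z ^ k) sums f ?z"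
        using a by (simp add: has_taylor_expansion_on_disk_def)
      then have "(\<lambda>k. (if k = 0 then of_real (disk_norm f) else 0) - u * (a k * ?z ^ k)) sums
          (of_real (disk_norm f) - u * f ?z)"
        by (intro sums_diff sums_mult sums_single[of 0 "\<lambda>_. of_real (disk_norm f)"])
      moreover have "(if k = 0 then of_real (disk_norm f) else 0) - u * (a k * ?z ^ k)
          = c k * cis (of_nat k * t)" for k
        by (auto simp: c_def power_mult_distrib Complex.DeMoivre)
      ultimately have "(\<Sum>k. c k * cis (of_nat k * t)) = of_real (disk_norm f) - u * f ?z"
        by (simp add: sums_iff)
      moreover have "Re (u * f ?z) \<le> disk_norm f"
        using complex_Re_le_cmod[of "u * f ?z"] norm_le_disk_norm[OF f, of ?z] z
        by (simp add: norm_mult u)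
      ultimately show ?thesis by simp
    qed
    ultimately have "norm (c n) \<le> 2 * Re (c 0)"
      using \<open>n > 0\<close> by (rule norm_coeff_le_twice_Re_const_coeff)
    then show ?thesis
      using \<open>n > 0\<close> s by (simp add: c_def norm_mult norm_power u)
  qed
  have "((\<lambda>s. norm (a n) * s ^ n) \<longlongrightarrow> norm (a n) * 1 ^ n) (at_left 1)"
    by (intro tendsto_intros)
  moreover have "\<forall>\<^sub>F s::real in at_left 1. norm (a n) * s ^ n \<le> 2 * (disk_norm f - norm (a 0))"
    by (rule eventually_mono[OF eventually_at_left_real[of 0]]) (use bound in auto)
  ultimately have "norm (a n) * 1 ^ n \<le> 2 * (disk_norm f - norm (a 0))"
    by (rule tendsto_upperbound) simp
  then show ?thesis by simp
qed

lemma bohr_inequality: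
  assumes f: "f \<in> disk_algebra" and a: "has_taylor_expansion_on_disk f a"
    and r: "0 \<le> r" "r \<le> 1 / 3"
  shows "summable (\<lambda>n. norm (a n) * r ^ n)" and "(\<Sum>n. norm (a n) * r ^ n) \<le> disk_norm f"
proof -
  define D where "D = disk_norm f - norm (a 0)"
  \<comment> \<open>The correction at index 0 replaces the first term \<open>2 * D\<close> of the
    geometric series by \<open>norm (a 0)\<close>. The full geometric series sums to
    \<open>3 * D\<close>, so \<open>b\<close> sums to \<open>norm (a 0) + D\<close>, which is
    \<open>disk_norm f\<close>.\<close>
  define b where "b = (\<lambda>n. (if n = 0 then norm (a 0) - 2 * D else 0) + 2 * D * (1 / 3 :: real) ^ n)"
  have "0 \<le> D"
    using norm_ge_zero[THEN order_trans, OF taylor_coeff_le[OF f a]] by (auto simp: D_def)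
  have le: "norm (a n) * r ^ n \<le> b n" for n
  proof (cases "n = 0")
    case False
    then show ?thesis
      using taylor_coeff_le[OF f a, of n] r \<open>0 \<le> D\<close>
      by (auto simp: b_def D_def intro!: mult_mono power_mono)
  qed (simp add: b_def)
  have "b sums ((norm (a 0) - 2 * D) + 2 * D * (1 / (1 - 1 / 3)))"
    unfolding b_def
    by (intro sums_add sums_mult geometric_sums sums_single[of 0 "\<lambda>_. norm (a 0) - 2 * D"]) simp
  then have b: "b sums disk_norm f"
    by (simp add: D_def field_simps)
  show summ: "summable (\<lambda>n. norm (a n) * r ^ n)"
    by (rule summable_comparison_test'[OF sums_summable[OF b], where N = 0]) (use le r in simp)
  show "(\<Sum>n. norm (a n) * r ^ n) \<le> disk_norm f"
    using suminf_le[OF le summ sums_summable[OF b]] b by (simp add: sums_iff)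
qed

section \<open>Optimality of 1/3\<close>

lemma bohr_radius_optimal:
  assumes \<rho>: "1 / 3 < \<rho>" "\<rho> < 1"
  obtains f a where "f \<in> disk_algebra" "has_taylor_expansion_on_disk f a"
    "summable (\<lambda>n. norm (a n) * \<rho> ^ n)" "(\<Sum>n. norm (a n) * \<rho> ^ n) > disk_norm f"
proof -
  define p where "p = (1 + 1 / \<rho>) / 4" \<comment> \<open>the midpoint of 1 and the threshold (1/\<rho> - 1)/2\<close>
  have p: "0 < p" "p < 1" "1 < \<rho> * (1 + 2 * p)"
    using \<rho> by (auto simp: p_def field_simps)
  define f :: "complex \<Rightarrow> complex" where "f = (\<lambda>z. (of_real p - z) / (1 - of_real p * z))"
  \<comment> \<open>Read off from \<open>f z = p - (1 - p^2) * z / (1 - p * z)\<close> by expanding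
    the geometric series; the factor \<open>z\<close> shifts the exponent to
    \<open>n - 1\<close>.\<close>
  define a where "a = (\<lambda>n. of_real (if n = 0 then p else - ((1 - p\<^sup>2) * p ^ (n - 1))) :: complex)"
  have nz: "1 - of_real p * z \<noteq> 0" if "norm z \<le> 1" for z :: complex
  proof
    assume "1 - of_real p * z = 0"
    then have "norm (of_real p * z) = norm (1::complex)" by simp
    moreover have "p * norm z \<le> p * 1"
      using that p by (intro mult_left_mono) auto
    ultimately show False using p by (simp add: norm_mult)
  qed
  have "f holomorphic_on ball 0 1"
    unfolding f_def by (intro holomorphic_on_divide holomorphic_intros) (use nz in auto)
  moreover have "continuous_on (cball 0 1) f"
    unfolding f_def by (intro continuous_intros) (use nz in auto)
  ultimately have "f \<in> disk_algebra"
    by (simp add: disk_algebra_def)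
  moreover have "has_taylor_expansion_on_disk f a"
    unfolding has_taylor_expansion_on_disk_def
  proof
    fix z :: complex
    assume "z \<in> ball 0 1"
    then have z: "norm z < 1" by simp
    have "norm (of_real p * z) < 1"
      using mult_strict_mono[of p 1 "norm z" 1] p z by (simp add: norm_mult)
    then have "(\<lambda>n. (of_real p * z) ^ n) sums (1 / (1 - of_real p * z))"
      by (rule geometric_sums)
    then have "(\<lambda>n. - (1 - of_real p ^ 2) * z * (of_real p * z) ^ n) sums
        (- (1 - of_real p ^ 2) * z * (1 / (1 - of_real p * z)))"
      by (rule sums_mult)
    then have "(\<lambda>n. a (Suc n) * z ^ Suc n) sums (- (1 - of_real p ^ 2) * z / (1 - of_real p * z))"
      by (simp add: a_def power_mult_distrib mult_ac del: minus_diff_eq)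
    then have "(\<lambda>n. a n * z ^ n) sums (- (1 - of_real p ^ 2) * z / (1 - of_real p * z) + a 0 * z ^ 0)"
      by (rule sums_Suc)
    moreover have "- (1 - of_real p ^ 2) * z / (1 - of_real p * z) + a 0 * z ^ 0 = f z"
      using nz[of z] z by (simp add: f_def a_def field_simps power2_eq_square)
    ultimately show "(\<lambda>n. a n * z ^ n) sums f z" by simp
  qed
  moreover have majorant: "(\<lambda>n. norm (a n) * \<rho> ^ n) sums ((1 - p\<^sup>2) * \<rho> / (1 - p * \<rho>) + p)"
  proof -
    have "norm (p * \<rho>) < 1"
      using mult_strict_mono[of p 1 \<rho> 1] p \<rho> by simp
    then have "(\<lambda>n. (p * \<rho>) ^ n) sums (1 / (1 - p * \<rho>))"
      by (rule geometric_sums)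
    then have "(\<lambda>n. (1 - p\<^sup>2) * \<rho> * (p * \<rho>) ^ n) sums ((1 - p\<^sup>2) * \<rho> * (1 / (1 - p * \<rho>)))"
      by (rule sums_mult)
    moreover have "(1 - p\<^sup>2) * \<rho> * (p * \<rho>) ^ n = norm (a (Suc n)) * \<rho> ^ Suc n" for n
      using p by (simp add: a_def norm_mult norm_power power_mult_distrib power_le_one abs_mult
        del: of_real_diff of_real_mult of_real_minus of_real_power)
    ultimately have "(\<lambda>n. norm (a (Suc n)) * \<rho> ^ Suc n) sums ((1 - p\<^sup>2) * \<rho> / (1 - p * \<rho>))"
      by simp
    then have "(\<lambda>n. norm (a n) * \<rho> ^ n) sums
        ((1 - p\<^sup>2) * \<rho> / (1 - p * \<rho>) + norm (a 0) * \<rho> ^ 0)"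
      by (rule sums_Suc)
    then show ?thesis
      using p by (simp add: a_def)
  qed
  moreover have "disk_norm f \<le> 1"
    unfolding disk_norm_def
  proof (rule cSUP_least)
    fix z :: complex
    assume "z \<in> cball 0 1"
    then have z: "norm z \<le> 1" by simp
    \<comment> \<open>This identity is why the automorphism maps the closed disk into itself: the
      right-hand side is nonnegative there.\<close>
    have "(norm (1 - of_real p * z))\<^sup>2 - (norm (of_real p - z))\<^sup>2 = (1 - p\<^sup>2) * (1 - (norm z)\<^sup>2)"
      unfolding cmod_power2 Re_complex_of_real Im_complex_of_real minus_complex.sel
        one_complex.sel times_complex.sel
      by algebra
    also have "\<dots> \<ge> 0"
      using p z by (intro mult_nonneg_nonneg) (auto simp: power_le_one)
    finally have "(norm (of_real p - z))\<^sup>2 \<le> (norm (1 - of_real p * z))\<^sup>2"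
      by simp
    then have "norm (of_real p - z) \<le> norm (1 - of_real p * z)"
      by (rule power2_le_imp_le) simp
    then show "norm (f z) \<le> 1"
      using nz[OF z] by (simp add: f_def norm_divide)
  qed simp
  moreover have "1 < (1 - p\<^sup>2) * \<rho> / (1 - p * \<rho>) + p"
  proof -
    have "p * \<rho> < 1"
      using mult_strict_mono[of p 1 \<rho> 1] p \<rho> by simp
    \<comment> \<open>After cancelling the positive factor \<open>1 - p\<close>, this is exactly
      \<open>1 < \<rho> * (1 + 2 * p)\<close>, the condition that determined the choice of
      \<open>p\<close>.\<close>
    moreover have "(1 - p) * (1 - p * \<rho>) < (1 - p) * ((1 + p) * \<rho>)"
      using p by (intro mult_strict_left_mono) (auto simp: algebra_simps)
    moreover have "(1 - p) * ((1 + p) * \<rho>) = (1 - p\<^sup>2) * \<rho>"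
      by algebra
    ultimately have "1 - p < (1 - p\<^sup>2) * \<rho> / (1 - p * \<rho>)"
      by (simp add: pos_less_divide_eq)
    then show ?thesis by simp
  qed
  ultimately show ?thesis
    by (intro that[of f a]) (auto simp: sums_iff)
qed

theorem mainTheorem1:
  shows "(\<forall>f\<in>disk_algebra. \<forall>a :: nat \<Rightarrow> complex. has_taylor_expansion_on_disk f a \<longrightarrow>
            (\<forall>r::real. 0 \<le> r \<and> r \<le> 1 / 3 \<longrightarrow>
               summable (\<lambda>n. norm (a n) * r ^ n) \<and>
               (\<Sum>n. norm (a n) * r ^ n) \<le> disk_norm f))
       \<and> (\<forall>\<rho>::real. 1 / 3 < \<rho> \<and> \<rho> < 1 \<longrightarrow>
            (\<exists>f\<in>disk_algebra. \<exists>a :: nat \<Rightarrow> complex. has_taylor_expansion_on_disk f a \<and>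
               (\<exists>r\<in>{0..\<rho>}.
                  summable (\<lambda>n. norm (a n) * r ^ n) \<and>
                  (\<Sum>n. norm (a n) * r ^ n) > disk_norm f)))"
proof (intro conjI ballI allI impI)
  fix \<rho> :: real
  assume "1 / 3 < \<rho> \<and> \<rho> < 1"
  then have \<rho>: "1 / 3 < \<rho>" "\<rho> < 1" by auto
  obtain f a where "f \<in> disk_algebra" "has_taylor_expansion_on_disk f a"
    "summable (\<lambda>n. norm (a n) * \<rho> ^ n)" "(\<Sum>n. norm (a n) * \<rho> ^ n) > disk_norm f"
    by (rule bohr_radius_optimal[OF \<rho>])
  moreover have "\<rho> \<in> {0..\<rho>}"
    using \<rho> by simp
  ultimately show "\<exists>f\<in>disk_algebra. \<exists>a :: nat \<Rightarrow> complex. has_taylor_expansion_on_disk f a \<and>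
               (\<exists>r\<in>{0..\<rho>}.
                  summable (\<lambda>n. norm (a n) * r ^ n) \<and>
                  (\<Sum>n. norm (a n) * r ^ n) > disk_norm f)"
    by blast
qed (blast intro: bohr_inequality)+

end
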